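(* Let $d\ge2$ be an integer, $0\le\eta\le1$, $0<r\le1$, and let $$\omega=\frac{d-1+\eta}{d-1}\,\frac{\mathbb{I}\otimes\mathbb{I}}{d^2}-\frac{\eta}{d-1}\,\frac{V}{d}$$ be the Werner state on $\mathbb{C}^d\otimes\mathbb{C}^d$, where $V$ is the flip operator, $V|ij\rangle=|ji\rangle$. Let $$\rho'=r\,\omega+(1-r)\,\frac{\mathbb{I}}{d}\otimes\omega_B,\qquad \omega_B=\mathrm{Tr}_A\,\omega .$$ If $\rho'$ admits a local hidden state (LHS) model, then its conditional Rényi 2-entropy is non-negative: $S_2(A|B)_{\rho'}\ge0$.
   Context: The first tensor factor is system $A$ (Alice) and the second is system $B$ (Bob); $\mathbb{I}$ is the identity on $\mathbb{C}^d$. LHS model: suppose Alice performs a projective measurement $x=\{P_{a|x}\}_a$ on system $A$ of a bipartite state $\rho$ and obtains outcome $a$. Bob is left with the unnormalized conditional state $\rho_{a|x}=\mathrm{Tr}_A[(P_{a|x}\otimes\mathbb{I})\rho]$. The state $\rho$ admits an LHS model (is unsteerable from Alice to Bob) if there are a hidden variable $\lambda$ with probability distribution $p(\lambda)$, states $\sigma_\lambda$ on system $B$, and response functions $p(a|x,\lambda)$ (for each $x$ and $\lambda$, a probability distribution over the outcomes $a$) such that $\rho_{a|x}=\int d\lambda\,p(\lambda)\,p(a|x,\lambda)\,\sigma_\lambda$ for all measurements $x$ and outcomes $a$. Rényi 2-entropy: $S_2(\rho)=-\log\mathrm{Tr}(\rho^2)$ (logarithm to base 2). Conditional Rényi 2-entropy: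 $S_2(A|B)_\rho=S_2(\rho)-S_2(\rho_B)$, where $\rho_B=\mathrm{Tr}_A\rho$. *)

theory Defs
  imports "HOL-Probability.Probability"
begin

text \<open>
  The Hilbert space of dimension \<open>d\<close> is \<open>complex ^ 'n\<close> with \<open>d = CARD('n)\<close>; the basis vector
  \<open>|ij>\<close> of a tensor product is the one with index \<open>(i, j)\<close>, Alice's index coming first.
\<close>

type_synonym 'n op = "complex ^ 'n ^ 'n"

definition dagger :: "'n::finite op \<Rightarrow> 'n op" where
  "dagger A = (\<chi> i j. cnj (A $ j $ i))"

definition positive_semidefinite :: "'n::finite op \<Rightarrow> bool" where
  "positive_semidefinite A \<longleftrightarrow>
     dagger A = A \<and> (\<forall>v. 0 \<le> Re (\<Sum>i\<in>UNIV. cnj (v $ i) * (A *v v) $ i))"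

definition quantum_state :: "'n::finite op \<Rightarrow> bool" where
  "quantum_state \<rho> \<longleftrightarrow> positive_semidefinite \<rho> \<and> trace \<rho> = 1"

definition tensor_op :: "'a::finite op \<Rightarrow> 'b::finite op \<Rightarrow> ('a \<times> 'b) op" (infixr "\<otimes>\<^sub>o" 72) where
  "A \<otimes>\<^sub>o B = (\<chi> p q. A $ fst p $ fst q * B $ snd p $ snd q)"

definition ptrace_A :: "('a::finite \<times> 'b::finite) op \<Rightarrow> 'b op" where
  "ptrace_A \<rho> = (\<chi> j j'. \<Sum>i\<in>UNIV. \<rho> $ (i, j) $ (i, j'))"

definition flip_op :: "('n::finite \<times> 'n) op" where
  "flip_op = (\<chi> p q. if p = prod.swap q then 1 else 0)"

lemma flip_op_basis: "flip_op *v axis (i, j) 1 = axis (j, i) 1"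
  by (simp add: flip_op_def vec_eq_iff matrix_vector_mult_def axis_def
      if_distrib[of "\<lambda>x. _ * x"] cong: if_cong)

definition werner_state :: "real \<Rightarrow> ('n::finite \<times> 'n) op" where
  "werner_state \<eta> = (let d = real CARD('n) in
     ((d - 1 + \<eta>) / (d - 1)) *\<^sub>R ((1 / d\<^sup>2) *\<^sub>R (mat 1 \<otimes>\<^sub>o mat 1))
       - (\<eta> / (d - 1)) *\<^sub>R ((1 / d) *\<^sub>R flip_op))"

text \<open>
  A projective measurement is the list of its projectors; its outcomes are the list positions.
\<close>

definition projective_measurement :: "'n::finite op list \<Rightarrow> bool" where
  "projective_measurement x \<longleftrightarrow>
     (\<forall>a<length x. dagger (x ! a) = x ! a \<and> x ! a ** x ! a = x ! a) \<and>
     (\<forall>a<length x. \<forall>b<length x. a \<noteq> b \<longrightarrow> x ! a ** x ! b = 0) \<and>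
     (\<Sum>a<length x. x ! a) = mat 1"

definition conditional_state ::
  "('a::finite \<times> 'b::finite) op \<Rightarrow> 'a op list \<Rightarrow> nat \<Rightarrow> 'b op" where
  "conditional_state \<rho> x a = ptrace_A ((x ! a \<otimes>\<^sub>o mat 1) ** \<rho>)"

text \<open>
  The distribution of the hidden variable is an arbitrary probability measure \<open>M\<close>, and
  \<open>p x a l\<close> stands for \<open>p(a|x,\<lambda>)\<close>. Measurability of \<open>\<sigma>\<close> and \<open>p x a\<close> need not be required
  separately: the integrands are measurable, summing them over \<open>a\<close> gives \<open>\<sigma>\<close>, and their trace
  is \<open>p x a\<close>.
\<close>

definition is_LHS_model ::
  "'l measure \<Rightarrow> ('a::finite op list \<Rightarrow> nat \<Rightarrow> 'l \<Rightarrow> real) \<Rightarrow> ('l \<Rightarrow> 'b::finite op)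
     \<Rightarrow> ('a \<times> 'b) op \<Rightarrow> bool" where
  "is_LHS_model M p \<sigma> \<rho> \<longleftrightarrow>
     prob_space M \<and>
     (\<forall>l\<in>space M. quantum_state (\<sigma> l)) \<and>
     (\<forall>x. projective_measurement x \<longrightarrow>
        (\<forall>l\<in>space M. (\<forall>a<length x. 0 \<le> p x a l) \<and> (\<Sum>a<length x. p x a l) = 1) \<and>
        (\<forall>a<length x.
           has_bochner_integral M (\<lambda>l. p x a l *\<^sub>R \<sigma> l) (conditional_state \<rho> x a)))"

text \<open>
  HOL cannot quantify over the type of the hidden variable inside a formula, so that type is a
  parameter. As a premise with a free type variable it covers every hidden-variable space.
\<close>

definition admits_LHS_model :: "'l itself \<Rightarrow> ('a::finite \<times> 'b::finite) op \<Rightarrow> bool" where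
  "admits_LHS_model _ \<rho> \<longleftrightarrow> (\<exists>(M :: 'l measure) p \<sigma>. is_LHS_model M p \<sigma> \<rho>)"

definition renyi2_entropy :: "'n::finite op \<Rightarrow> real" where
  "renyi2_entropy \<rho> = - log 2 (Re (trace (\<rho> ** \<rho>)))"

definition cond_renyi2_entropy :: "('a::finite \<times> 'b::finite) op \<Rightarrow> real" where
  "cond_renyi2_entropy \<rho> = renyi2_entropy \<rho> - renyi2_entropy (ptrace_A \<rho>)"

end

theory Submission
  imports Defs
begin

text \<open>
  Since \<open>\<omega>\<^sub>B = \<one>/d\<close>, the state \<open>\<rho>'\<close> is the Werner state with parameter \<open>r \<eta>\<close>. Its purity is at
  most \<open>1/d\<close> iff \<open>(r \<eta>)\<^sup>2 (d + 1) \<le> (d - 1)\<^sup>2\<close>, which for \<open>d \<ge> 3\<close> follows from \<open>r \<eta> \<le> 1\<close>.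
  For \<open>d = 2\<close> the condition is \<open>3 (r \<eta>)\<^sup>2 \<le> 1\<close>; this is the three-setting linear steering
  inequality for the Pauli observables, which any LHS model obeys because the Bloch vector of a
  hidden state has norm at most \<open>1\<close>.
\<close>

section \<open>Linearity of tensor product, matrix product, trace and partial trace\<close>

lemma tensor_mat_1: "mat 1 \<otimes>\<^sub>o mat 1 = mat 1"
  by (auto simp: tensor_op_def mat_def vec_eq_iff prod_eq_iff)

lemma tensor_scaleR_left: "(c *\<^sub>R A) \<otimes>\<^sub>o B = c *\<^sub>R (A \<otimes>\<^sub>o B)"
  by (simp add: tensor_op_def vec_eq_iff)

lemma tensor_scaleR_right: "A \<otimes>\<^sub>o (c *\<^sub>R B) = c *\<^sub>R (A \<otimes>\<^sub>o B)"
  by (simp add: tensor_op_def vec_eq_iff)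

lemma scaleR_matrix_mult: "(c *\<^sub>R A) ** B = c *\<^sub>R (A ** B)" for A B :: "'n::finite op"
  by (simp add: matrix_matrix_mult_def vec_eq_iff scaleR_sum_right)

lemma matrix_mult_scaleR: "A ** (c *\<^sub>R B) = c *\<^sub>R (A ** B)" for A B :: "'n::finite op"
  by (simp add: matrix_matrix_mult_def vec_eq_iff scaleR_sum_right)

lemma matrix_diff_rdistrib: "(A - B) ** C = A ** C - B ** C" for A B C :: "'n::finite op"
  by (simp add: matrix_matrix_mult_def vec_eq_iff left_diff_distrib sum_subtractf)

lemma matrix_diff_ldistrib: "A ** (B - C) = A ** B - A ** C" for A B C :: "'n::finite op"
  by (simp add: matrix_matrix_mult_def vec_eq_iff right_diff_distrib sum_subtractf)

lemma matrix_add_rdistrib: "(A + B) ** C = A ** C + B ** C" for A B C :: "'n::finite op"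
  by (simp add: matrix_matrix_mult_def vec_eq_iff distrib_right sum.distrib)

lemmas matrix_bilinear = scaleR_matrix_mult matrix_mult_scaleR
  matrix_diff_rdistrib matrix_diff_ldistrib matrix_add_ldistrib matrix_add_rdistrib

lemma trace_scaleR: "trace (c *\<^sub>R A) = c *\<^sub>R trace A" for A :: "'n::finite op"
  by (simp add: trace_def scaleR_sum_right)

lemma ptrace_A_scaleR: "ptrace_A (c *\<^sub>R A) = c *\<^sub>R ptrace_A A"
  by (simp add: ptrace_A_def vec_eq_iff scaleR_sum_right)

lemma ptrace_A_diff: "ptrace_A (A - B) = ptrace_A A - ptrace_A B"
  by (simp add: ptrace_A_def vec_eq_iff sum_subtractf)

section \<open>The flip operator\<close>

lemma flip_op_nth: "flip_op $ p $ q = (if p = prod.swap q then 1 else 0)"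
  by (simp add: flip_op_def)

lemma matrix_mult_flip_op_nth: "(A ** flip_op) $ p $ q = A $ p $ prod.swap q"
  by (simp add: matrix_matrix_mult_def flip_op_nth if_distrib[of "\<lambda>x. _ * x"] cong: if_cong)

lemma flip_op_flip_op: "flip_op ** flip_op = mat 1"
  by (auto simp: vec_eq_iff matrix_mult_flip_op_nth flip_op_nth mat_def)

lemma trace_flip_op: "trace (flip_op :: ('n::finite \<times> 'n) op) = of_nat CARD('n)"
proof -
  have "trace (flip_op :: ('n \<times> 'n) op)
      = (\<Sum>(i, j)\<in>UNIV \<times> UNIV. if i = (j :: 'n) then 1 else 0)"
    by (auto simp: trace_def flip_op_nth intro!: sum.cong)
  also have "\<dots> = (\<Sum>i\<in>UNIV. \<Sum>j\<in>UNIV. if i = (j :: 'n) then 1 else 0)"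
    by (simp only: sum.cartesian_product)
  finally show ?thesis by simp
qed

text \<open>The flip carries Alice's operator over to Bob unchanged; this makes the conditional
  states of a Werner state explicit.\<close>

lemma ptrace_A_tensor_mult_flip_op: "ptrace_A ((P \<otimes>\<^sub>o mat 1) ** flip_op) = P"
  by (simp add: ptrace_A_def vec_eq_iff matrix_mult_flip_op_nth tensor_op_def mat_def
      if_distrib[of "\<lambda>x. _ * x"] cong: if_cong)

lemma ptrace_A_tensor: "ptrace_A (A \<otimes>\<^sub>o B) = (\<chi> i j. trace A * B $ i $ j)"
  by (simp add: ptrace_A_def vec_eq_iff tensor_op_def trace_def sum_distrib_right)

section \<open>Werner states: marginals, depolarization, purity and entropy\<close>

lemma werner_state_eq:
  fixes \<eta> :: real
  assumes "d = real CARD('n::finite)" and "b = \<eta> / (d - 1)" and "CARD('n) \<ge> 2"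
  shows "(werner_state \<eta> :: ('n \<times> 'n) op) = ((1 + b) / d\<^sup>2) *\<^sub>R mat 1 - (b / d) *\<^sub>R flip_op"
proof -
  have "(d - 1 + \<eta>) / (d - 1) = 1 + b"
    using assms by (simp add: field_simps)
  then have "(d - 1 + \<eta>) / (d - 1) * (1 / d\<^sup>2) = (1 + b) / d\<^sup>2"
    by simp
  moreover have "\<eta> / (d - 1) * (1 / d) = b / d"
    by (simp add: assms(2))
  ultimately show ?thesis
    unfolding werner_state_def Let_def tensor_mat_1 scaleR_scaleR assms(1)[symmetric] by simp
qed

lemma conditional_state_werner:
  fixes \<eta> :: real and x :: "'n::finite op list"
  assumes "d = real CARD('n)" and "b = \<eta> / (d - 1)" and "CARD('n) \<ge> 2"
  shows "conditional_state (werner_state \<eta>) x a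
    = (\<chi> i j. ((1 + b) / d\<^sup>2) *\<^sub>R (trace (x ! a) * mat 1 $ i $ j)) - (b / d) *\<^sub>R (x ! a)"
  by (simp add: conditional_state_def werner_state_eq[OF assms] matrix_bilinear ptrace_A_diff
      ptrace_A_scaleR ptrace_A_tensor ptrace_A_tensor_mult_flip_op vec_eq_iff)

lemma ptrace_A_werner:
  assumes "CARD('n::finite) \<ge> 2"
  shows "ptrace_A (werner_state \<eta> :: ('n \<times> 'n) op) = (1 / real CARD('n)) *\<^sub>R mat 1"
proof -
  define d where "d = real CARD('n)"
  define b where "b = \<eta> / (d - 1)"
  \<comment> \<open>The marginal is the conditional state of the trivial measurement, whose only
    outcome has projector \<open>mat 1\<close>.\<close>
  have "ptrace_A (werner_state \<eta> :: ('n \<times> 'n) op)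
      = conditional_state (werner_state \<eta> :: ('n \<times> 'n) op) [mat 1] 0"
    by (simp add: conditional_state_def tensor_mat_1)
  also have "\<dots> = ((1 + b) / d\<^sup>2 * d - b / d) *\<^sub>R mat 1"
    \<comment> \<open>The type instance keeps \<open>scaleR_conv_of_real\<close> off the matrices, which form a
      (componentwise) real algebra themselves.\<close>
    unfolding conditional_state_werner[OF d_def b_def assms]
    by (simp add: trace_I d_def vec_eq_iff scaleR_conv_of_real[where 'a = complex] algebra_simps)
  also have "(1 + b) / d\<^sup>2 * d - b / d = 1 / d"
    using assms by (simp add: d_def field_simps power2_eq_square)
  finally show ?thesis by (simp add: d_def)
qed

text \<open>As Bob's marginal is maximally mixed, the admixture is white noise. It scales the flip
  term by \<open>r\<close>, and the identity coefficient follows suit because the trace stays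
  1.\<close>

lemma werner_state_depolarize:
  assumes "CARD('n::finite) \<ge> 2"
  shows "r *\<^sub>R werner_state \<eta> + (1 - r) *\<^sub>R (((1 / real CARD('n)) *\<^sub>R mat 1)
      \<otimes>\<^sub>o ptrace_A (werner_state \<eta>)) = (werner_state (r * \<eta>) :: ('n \<times> 'n) op)"
proof -
  define d where "d = real CARD('n)"
  have d: "d \<ge> 2" using assms by (simp add: d_def)
  have "r * ((1 + \<eta> / (d - 1)) / d\<^sup>2) + (1 - r) * (1 / d * (1 / d)) = (1 + r * \<eta> / (d - 1)) / d\<^sup>2"
    using d by (simp add: field_simps power2_eq_square)
  then have "(werner_state (r * \<eta>) :: ('n \<times> 'n) op)
      = (r * ((1 + \<eta> / (d - 1)) / d\<^sup>2) + (1 - r) * (1 / d * (1 / d))) *\<^sub>R mat 1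
        - (r * (\<eta> / (d - 1) / d)) *\<^sub>R flip_op"
    by (simp add: werner_state_eq[OF d_def refl assms])
  then show ?thesis
    unfolding ptrace_A_werner[OF assms]
    by (simp add: werner_state_eq[OF d_def refl assms] tensor_mat_1
        tensor_scaleR_left tensor_scaleR_right scaleR_diff_right scaleR_add_left flip: d_def)
qed

text \<open>Expand the square, using V^2 = 1, tr V = d and tr 1 = d^2.\<close>

lemma purity_werner:
  fixes \<eta> :: real
  assumes "d = real CARD('n::finite)" and "b = \<eta> / (d - 1)" and "CARD('n) \<ge> 2"
  shows "trace (werner_state \<eta> ** (werner_state \<eta> :: ('n \<times> 'n) op))
    = of_real (1 / d\<^sup>2 + b\<^sup>2 * (1 - 1 / d\<^sup>2))"
proof -
  have d: "d \<ge> 2" using assms by simp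
  define \<alpha> where "\<alpha> = (1 + b) / d\<^sup>2"
  define \<beta> where "\<beta> = b / d"
  have "trace (werner_state \<eta> ** (werner_state \<eta> :: ('n \<times> 'n) op))
      = of_real (\<alpha>\<^sup>2 * d\<^sup>2 - 2 * \<alpha> * \<beta> * d + \<beta>\<^sup>2 * d\<^sup>2)"
    unfolding werner_state_eq[OF assms] \<alpha>_def[symmetric] \<beta>_def[symmetric]
    by (simp add: matrix_bilinear trace_sub trace_scaleR trace_I flip_op_flip_op trace_flip_op)
      (simp add: scaleR_conv_of_real[where 'a = complex] assms(1) power2_eq_square algebra_simps)
  also have "\<alpha>\<^sup>2 * d\<^sup>2 - 2 * \<alpha> * \<beta> * d + \<beta>\<^sup>2 * d\<^sup>2 = 1 / d\<^sup>2 + b\<^sup>2 * (1 - 1 / d\<^sup>2)"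
    using d by (simp add: \<alpha>_def \<beta>_def field_simps power2_eq_square)
  finally show ?thesis .
qed

lemma cond_renyi2_entropy_werner_nonneg:
  fixes \<eta> :: real
  assumes "CARD('n::finite) \<ge> 2"
    and "\<eta>\<^sup>2 * (real CARD('n) + 1) \<le> (real CARD('n) - 1)\<^sup>2"
  shows "cond_renyi2_entropy (werner_state \<eta> :: ('n \<times> 'n) op) \<ge> 0"
proof -
  define d where "d = real CARD('n)"
  define b where "b = \<eta> / (d - 1)"
  define T where "T = 1 / d\<^sup>2 + b\<^sup>2 * (1 - 1 / d\<^sup>2)"
  have d: "d \<ge> 2" using assms by (simp add: d_def)
  \<comment> \<open>This is the second assumption divided by (d - 1)^2.\<close>
  have "b\<^sup>2 * (d + 1) \<le> 1"
    using assms(2) d by (simp add: b_def power_divide field_simps flip: d_def)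
  \<comment> \<open>The target is T <= 1/d, and d^2 T = 1 + b^2 (d + 1) (d - 1).\<close>
  then have "b\<^sup>2 * (d + 1) * (d - 1) \<le> 1 * (d - 1)"
    using d by (intro mult_right_mono) auto
  then have "(1 + b\<^sup>2 * (d + 1) * (d - 1)) / d\<^sup>2 \<le> d / d\<^sup>2"
    by (intro divide_right_mono) auto
  then have "T \<le> 1 / d"
    using d by (simp add: T_def field_simps power2_eq_square)
  moreover have "T > 0"
    using d by (auto simp: T_def intro!: add_pos_nonneg mult_nonneg_nonneg)
  ultimately have "log 2 T \<le> log 2 (1 / d)" by (intro log_mono) auto
  moreover have "renyi2_entropy (werner_state \<eta> :: ('n \<times> 'n) op) = - log 2 T"
    by (simp add: renyi2_entropy_def purity_werner[OF d_def b_def assms(1)] T_def)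
  moreover have "renyi2_entropy (ptrace_A (werner_state \<eta> :: ('n \<times> 'n) op)) = - log 2 (1 / d)"
    using d by (simp add: renyi2_entropy_def ptrace_A_werner[OF assms(1)] matrix_bilinear
        trace_scaleR trace_I d_def)
  ultimately show ?thesis by (simp add: cond_renyi2_entropy_def)
qed

section \<open>Two-outcome measurements and their correlators\<close>

definition spectral_measurement :: "'n::finite op \<Rightarrow> 'n op list" where
  "spectral_measurement S = [(1/2) *\<^sub>R (mat 1 + S), (1/2) *\<^sub>R (mat 1 - S)]"

text \<open>A Hermitian involution has eigenvalues in {1, -1}; outcomes 0 and 1 project onto the
  respective eigenspaces.\<close>

lemma projective_spectral_measurement:
  assumes "dagger S = S" and "S ** S = mat 1"
  shows "projective_measurement (spectral_measurement S)"
proof -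
  have dag: "dagger ((1/2) *\<^sub>R (mat 1 + S)) = (1/2) *\<^sub>R (mat 1 + S)"
    "dagger ((1/2) *\<^sub>R (mat 1 - S)) = (1/2) *\<^sub>R (mat 1 - S)"
    using assms(1) by (auto simp: dagger_def vec_eq_iff mat_def)
  have half: "(1/2) *\<^sub>R A + (1/2) *\<^sub>R A = A" for A :: "'n::finite op"
    by (simp flip: scaleR_add_left)
  show ?thesis
    unfolding projective_measurement_def spectral_measurement_def
    by (auto simp: less_Suc_eq dag[unfolded scaleR_add_right scaleR_diff_right] matrix_bilinear
        assms(2) half scaleR_add_right scaleR_diff_right simp flip: scaleR_add_left)
qed

lemma correlator_werner:
  fixes \<eta> :: real and S :: "'n::finite op"
  assumes "CARD('n) \<ge> 2" and "S ** S = mat 1" and "trace S = 0"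
  shows "trace (S ** (conditional_state (werner_state \<eta>) (spectral_measurement S) 0
      - conditional_state (werner_state \<eta>) (spectral_measurement S) 1))
    = - of_real (\<eta> / (real CARD('n) - 1))"
proof -
  define d where "d = real CARD('n)"
  define b where "b = \<eta> / (d - 1)"
  \<comment> \<open>The identity part of a conditional state depends only on the trace of the
    projector. Both traces are d/2 because \<open>S\<close> is traceless, so these parts cancel. The
    flip parts leave the difference of the projectors, which is \<open>S\<close>.\<close>
  have "conditional_state (werner_state \<eta>) (spectral_measurement S) 0
      - conditional_state (werner_state \<eta>) (spectral_measurement S) 1 = (- (b / d)) *\<^sub>R S"
    by (simp add: conditional_state_werner[OF d_def b_def assms(1)] spectral_measurement_def
        vec_eq_iff trace_scaleR trace_add trace_sub assms(3)
        scaleR_conv_of_real[where 'a = complex] field_simps)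
  then show ?thesis
    using assms by (simp only: matrix_bilinear trace_scaleR)
      (simp add: trace_I scaleR_conv_of_real[where 'a = complex] b_def d_def)
qed

text \<open>A real-linear functional on a finite-dimensional space is bounded, hence commutes with
  the Bochner integral. Bob's observable \<open>B\<close> will later be the one that Alice
  measures.\<close>

lemma LHS_correlator_integral:
  fixes \<rho> :: "('n::finite \<times> 'm::finite) op" and B :: "'m op"
  assumes "is_LHS_model M p \<sigma> \<rho>" and "projective_measurement x" and "length x = 2"
  shows "has_bochner_integral M (\<lambda>l. (p x 0 l - p x 1 l) * Re (trace (B ** \<sigma> l)))
    (Re (trace (B ** (conditional_state \<rho> x 0 - conditional_state \<rho> x 1))))"
proof -
  define f where "f = (\<lambda>A :: 'm op. Re (trace (B ** A)))"
  have lin: "linear f"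
    by (intro linearI) (simp_all add: f_def matrix_bilinear trace_add trace_scaleR)
  then have "bounded_linear f" by (simp add: linear_conv_bounded_linear)
  moreover have "has_bochner_integral M (\<lambda>l. p x 0 l *\<^sub>R \<sigma> l - p x 1 l *\<^sub>R \<sigma> l)
      (conditional_state \<rho> x 0 - conditional_state \<rho> x 1)"
    using assms by (intro has_bochner_integral_diff) (auto simp: is_LHS_model_def)
  ultimately have "has_bochner_integral M (\<lambda>l. f (p x 0 l *\<^sub>R \<sigma> l - p x 1 l *\<^sub>R \<sigma> l))
      (f (conditional_state \<rho> x 0 - conditional_state \<rho> x 1))"
    by (rule has_bochner_integral_bounded_linear)
  moreover have "f (c *\<^sub>R A - c' *\<^sub>R A) = (c - c') * f A" for c c' A
    using lin by (simp add: linear_cmul flip: scaleR_diff_left)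
  ultimately show ?thesis by (simp add: f_def)
qed

lemma LHS_response_diff_bound:
  assumes "is_LHS_model M p \<sigma> \<rho>" and "projective_measurement x" and "length x = 2"
    and "l \<in> space M"
  shows "\<bar>p x 0 l - p x 1 l\<bar> \<le> 1"
proof -
  have "\<forall>a<2. 0 \<le> p x a l" "(\<Sum>a<2. p x a l) = 1"
    using assms unfolding is_LHS_model_def by metis+
  then have "0 \<le> p x 0 l" "0 \<le> p x 1 l" "p x 0 l + p x 1 l = 1"
    by (simp_all add: numeral_2_eq_2)
  then show ?thesis by linarith
qed

text \<open>Cauchy-Schwarz against (1, 1, 1), obtained from the squares of the pairwise
  differences.\<close>

lemma sum_le_sqrt_3:
  fixes x y z :: real
  assumes "x\<^sup>2 + y\<^sup>2 + z\<^sup>2 \<le> 1"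
  shows "\<bar>x\<bar> + \<bar>y\<bar> + \<bar>z\<bar> \<le> sqrt 3"
proof (rule real_le_rsqrt)
  have "0 \<le> (\<bar>x\<bar> - \<bar>y\<bar>)\<^sup>2 + (\<bar>y\<bar> - \<bar>z\<bar>)\<^sup>2 + (\<bar>z\<bar> - \<bar>x\<bar>)\<^sup>2" by simp
  then have "(\<bar>x\<bar> + \<bar>y\<bar> + \<bar>z\<bar>)\<^sup>2 \<le> 3 * (\<bar>x\<bar>\<^sup>2 + \<bar>y\<bar>\<^sup>2 + \<bar>z\<bar>\<^sup>2)"
    by (simp add: power2_eq_square algebra_simps)
  then show "(\<bar>x\<bar> + \<bar>y\<bar> + \<bar>z\<bar>)\<^sup>2 \<le> 3" using assms by simp
qed

section \<open>Qubits: Pauli observables, the Bloch ball and the steering inequality\<close>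

locale qubit =
  fixes u v :: "'n::finite"
  assumes UNIV_eq: "UNIV = {u, v}" and distinct: "u \<noteq> v"
begin

lemma sum_UNIV: "sum f UNIV = f u + f v"
  using distinct by (simp add: UNIV_eq)

lemma all_iff: "(\<forall>i. P i) \<longleftrightarrow> P u \<and> P v"
  using UNIV_eq by (metis (mono_tags) UNIV_I insertE singletonD)

definition pauli_x :: "'n op" where
  "pauli_x = (\<chi> i j. if i = j then 0 else 1)"

definition pauli_y :: "'n op" where
  "pauli_y = (\<chi> i j. if i = j then 0 else if i = u then - \<i> else \<i>)"

definition pauli_z :: "'n op" where
  "pauli_z = (\<chi> i j. if i \<noteq> j then 0 else if i = u then 1 else - 1)"

lemma pauli_simps:
  "dagger pauli_x = pauli_x" "pauli_x ** pauli_x = mat 1" "trace pauli_x = 0"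
  "dagger pauli_y = pauli_y" "pauli_y ** pauli_y = mat 1" "trace pauli_y = 0"
  "dagger pauli_z = pauli_z" "pauli_z ** pauli_z = mat 1" "trace pauli_z = 0"
  using distinct distinct[symmetric]
  by (simp_all add: pauli_x_def pauli_y_def pauli_z_def dagger_def vec_eq_iff all_iff trace_def
      sum_UNIV matrix_matrix_mult_def mat_def)

text \<open>
  With \<open>D = det A\<close>, the vectors \<open>(- A\<^sub>u\<^sub>v, A\<^sub>u\<^sub>u)\<close> and \<open>(A\<^sub>v\<^sub>v, - A\<^sub>v\<^sub>u)\<close> give \<open>A\<^sub>u\<^sub>u D \<ge> 0\<close> and
  \<open>A\<^sub>v\<^sub>v D \<ge> 0\<close>, hence \<open>D = D tr A \<ge> 0\<close>.
\<close>

lemma bloch_vector_norm: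
  assumes "quantum_state A"
  shows "(Re (trace (pauli_x ** A)))\<^sup>2 + (Re (trace (pauli_y ** A)))\<^sup>2
    + (Re (trace (pauli_z ** A)))\<^sup>2 \<le> 1"
proof -
  have herm: "cnj (A $ j $ i) = A $ i $ j" for i j
    using assms by (simp add: quantum_state_def positive_semidefinite_def dagger_def vec_eq_iff)
  define s where "s = Re (A $ u $ u)"
  define t where "t = Re (A $ v $ v)"
  define a where "a = Re (A $ u $ v)"
  define b where "b = Im (A $ u $ v)"
  have A: "A $ u $ u = complex_of_real s" "A $ v $ v = complex_of_real t"
    "A $ u $ v = Complex a b" "A $ v $ u = Complex a (- b)"
    using herm[of u u] herm[of v v] herm[of v u]
    by (auto simp: complex_eq_iff s_def t_def a_def b_def)
  have psd: "0 \<le> Re (cnj (w $ u) * (A *v w) $ u + cnj (w $ v) * (A *v w) $ v)" for w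
    using assms by (simp add: quantum_state_def positive_semidefinite_def sum_UNIV)
  have "0 \<le> s * (s * t - a\<^sup>2 - b\<^sup>2)"
    using psd[of "\<chi> i. if i = u then - Complex a b else of_real s"] distinct
    by (simp add: matrix_vector_mult_def sum_UNIV A power2_eq_square algebra_simps)
  moreover have "0 \<le> t * (s * t - a\<^sup>2 - b\<^sup>2)"
    using psd[of "\<chi> i. if i = u then of_real t else - Complex a (- b)"] distinct
    by (simp add: matrix_vector_mult_def sum_UNIV A power2_eq_square algebra_simps)
  ultimately have "0 \<le> (s + t) * (s * t - a\<^sup>2 - b\<^sup>2)"
    by (simp add: distrib_right)
  moreover have st: "s + t = 1"
    using assms by (simp add: quantum_state_def trace_def sum_UNIV A complex_eq_iff)
  \<comment> \<open>The squared length of the Bloch vector is (tr A)^2 - 4 det A.\<close>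
  moreover have "(2 * a)\<^sup>2 + (2 * b)\<^sup>2 + (s - t)\<^sup>2 = (s + t)\<^sup>2 - 4 * (s * t - a\<^sup>2 - b\<^sup>2)"
    by (simp add: power2_eq_square algebra_simps)
  ultimately have "(2 * a)\<^sup>2 + (2 * b)\<^sup>2 + (s - t)\<^sup>2 \<le> (s + t)\<^sup>2"
    by simp
  \<comment> \<open>The y component is in fact -2 b; its sign disappears on squaring.\<close>
  moreover have "Re (trace (pauli_x ** A)) = 2 * a" "\<bar>Re (trace (pauli_y ** A))\<bar> = \<bar>2 * b\<bar>"
    "Re (trace (pauli_z ** A)) = s - t"
    using distinct distinct[symmetric]
    by (auto simp: pauli_x_def pauli_y_def pauli_z_def trace_def sum_UNIV A
        matrix_matrix_mult_def)
  ultimately show ?thesis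
    by (metis st one_power2 power2_abs)
qed

lemma unsteerable_werner_bound:
  assumes "is_LHS_model M p \<sigma> (werner_state \<eta> :: ('n \<times> 'n) op)"
  shows "3 * \<eta> \<le> sqrt 3"
proof -
  interpret prob_space M using assms by (simp add: is_LHS_model_def)
  have card: "CARD('n) = 2" using distinct by (simp add: UNIV_eq)
  \<comment> \<open>\<open>c S l\<close> is Alice's mean outcome, with values 1 and -1, given the
    hidden variable. \<open>g S l\<close> is the hidden correlator, whose average is -\<eta> for
    each Pauli observable since d - 1 = 1.\<close>
  define c where "c S l = p (spectral_measurement S) 0 l - p (spectral_measurement S) 1 l" for S l
  define g where "g S l = c S l * Re (trace (S ** \<sigma> l))" for S l
  have int: "has_bochner_integral M (g S) (- \<eta>)" and c: "l \<in> space M \<Longrightarrow> \<bar>c S l\<bar> \<le> 1"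
    if "dagger S = S" "S ** S = mat 1" "trace S = 0" for S l
  proof -
    have x: "projective_measurement (spectral_measurement S)" "length (spectral_measurement S) = 2"
      using projective_spectral_measurement[OF that(1,2)] by (simp_all add: spectral_measurement_def)
    show "has_bochner_integral M (g S) (- \<eta>)"
      using LHS_correlator_integral[OF assms x, of S] correlator_werner[of S \<eta>] that card
      by (simp add: g_def[abs_def] c_def)
    show "\<bar>c S l\<bar> \<le> 1" if "l \<in> space M"
      using LHS_response_diff_bound[OF assms x that] by (simp add: c_def)
  qed
  have "has_bochner_integral M (\<lambda>l. g pauli_x l + g pauli_y l + g pauli_z l) (- \<eta> + - \<eta> + - \<eta>)"
    by (intro has_bochner_integral_add int pauli_simps)
  moreover have "has_bochner_integral M (\<lambda>l. - sqrt 3) (- sqrt 3)"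
    using has_bochner_integral_integrable[of M "\<lambda>l. - sqrt 3"] prob_space by simp
  \<comment> \<open>Alice's means have modulus at most 1, so the sum is controlled by the 1-norm of
    the Bloch vector of the hidden state.\<close>
  moreover have "- sqrt 3 \<le> g pauli_x l + g pauli_y l + g pauli_z l" if l: "l \<in> space M" for l
  proof -
    have "quantum_state (\<sigma> l)" using assms l by (simp add: is_LHS_model_def)
    note sum_le_sqrt_3[OF bloch_vector_norm[OF this]]
    moreover have "\<bar>g S l\<bar> \<le> \<bar>Re (trace (S ** \<sigma> l))\<bar>"
      if "dagger S = S" "S ** S = mat 1" "trace S = 0" for S
      using mult_right_mono[OF c[OF that l], of "\<bar>Re (trace (S ** \<sigma> l))\<bar>"]
      by (simp add: g_def abs_mult)
    note this[OF pauli_simps(1-3)] this[OF pauli_simps(4-6)] this[OF pauli_simps(7-9)]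
    ultimately show ?thesis by linarith
  qed
  ultimately have "- sqrt 3 \<le> - \<eta> + - \<eta> + - \<eta>"
    unfolding has_bochner_integral_iff
    using integral_mono[of M "\<lambda>l. - sqrt 3" "\<lambda>l. g pauli_x l + g pauli_y l + g pauli_z l"]
    by simp
  then show ?thesis by simp
qed

end

theorem mainTheorem9:
  fixes \<eta> r :: real
    and \<omega> \<rho>' :: "('n::finite \<times> 'n) op"
  assumes "CARD('n) \<ge> 2"
    and "0 \<le> \<eta>" and "\<eta> \<le> 1"
    and "0 < r" and "r \<le> 1"
    and "\<omega> = werner_state \<eta>"
    and "\<rho>' = r *\<^sub>R \<omega> + (1 - r) *\<^sub>R (((1 / real CARD('n)) *\<^sub>R mat 1) \<otimes>\<^sub>o ptrace_A \<omega>)"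
    and "admits_LHS_model TYPE('l) \<rho>'"
  shows "cond_renyi2_entropy \<rho>' \<ge> 0"
proof -
  define t where "t = r * \<eta>"
  have \<rho>': "\<rho>' = werner_state t"
    using werner_state_depolarize[OF assms(1)] assms(6,7) by (simp add: t_def)
  have t: "0 \<le> t" "t \<le> 1"
    using assms by (auto simp: t_def intro: mult_le_one)
  have "t\<^sup>2 * (real CARD('n) + 1) \<le> (real CARD('n) - 1)\<^sup>2"
  proof (cases "CARD('n) = 2")
    case True
    then obtain u v :: 'n where "UNIV = {u, v}" "u \<noteq> v"
      by (auto simp: card_2_iff)
    then interpret qubit u v by unfold_locales
    have "3 * t \<le> sqrt 3"
      using assms(8) unsteerable_werner_bound by (auto simp: admits_LHS_model_def \<rho>')
    \<comment> \<open>Squaring yields 3 t^2 <= 1, which is the claim at d = 2.\<close>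
    then have "(3 * t)\<^sup>2 \<le> (sqrt 3)\<^sup>2"
      using t by (intro power_mono) auto
    then show ?thesis by (simp add: True power_mult_distrib)
  next
    case False
    then have d: "real CARD('n) \<ge> 3" using assms(1) by simp
    have "t\<^sup>2 * (real CARD('n) + 1) \<le> 1 * (real CARD('n) + 1)"
      using t by (intro mult_right_mono) (auto simp: power_le_one)
    \<comment> \<open>Expanded, this says 3 d <= d^2.\<close>
    also have "\<dots> \<le> (real CARD('n) - 1)\<^sup>2"
      using mult_right_mono[OF d, of "real CARD('n)"] by (simp add: power2_eq_square algebra_simps)
    finally show ?thesis .
  qed
  then show ?thesis
    using cond_renyi2_entropy_werner_nonneg[OF assms(1)] by (simp add: \<rho>')
qed

end
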